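(* Let $G$ be a connected, well-edge-dominated graph containing exactly one triangle $xyz$. If $\deg_G(y)=2$, $\deg_G(x)\ge 3$ and $\deg_G(z)\ge 3$, then $G\in\{\mathcal{H},\mathcal{DH}\}$.
   Context: All graphs are simple and finite. A set $F$ of edges of $G$ is an edge dominating set if every edge of $G$ is in $F$ or shares an endpoint with an edge of $F$. $G$ is well-edge-dominated if all minimal (with respect to inclusion) edge dominating sets of $G$ have the same cardinality. A triangle is a subgraph isomorphic to $K_3$. The house graph $\mathcal{H}$ has vertices $p_1,\dots,p_5$ and edges $p_1p_2,p_2p_3,p_3p_4,p_4p_1,p_3p_5,p_4p_5$. The dream house $\mathcal{DH}$ has vertices $q_1,\dots,q_7$ and edges $q_1q_2,q_2q_3,q_3q_4,q_4q_1,q_2q_5,q_3q_6,q_5q_6,q_5q_7,q_6q_7$. Membership in $\{\mathcal{H},\mathcal{DH}\}$ is up to isomorphism. *)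

theory Defs
  imports Main
begin

datatype 'a ugraph = UGraph (verts: "'a set") (edges: "'a set set")

definition simple_graph :: "'a ugraph \<Rightarrow> bool" where
  "simple_graph G \<longleftrightarrow> finite (verts G) \<and> (\<forall>e\<in>edges G. e \<subseteq> verts G \<and> card e = 2)"

definition connected_graph :: "'a ugraph \<Rightarrow> bool" where
  "connected_graph G \<longleftrightarrow> verts G \<noteq> {} \<and>
     (\<forall>u\<in>verts G. \<forall>v\<in>verts G. (\<lambda>a b. {a, b} \<in> edges G)\<^sup>*\<^sup>* u v)"

definition degree :: "'a ugraph \<Rightarrow> 'a \<Rightarrow> nat" where
  "degree G v = card {e \<in> edges G. v \<in> e}"

definition subgraph :: "'a ugraph \<Rightarrow> 'a ugraph \<Rightarrow> bool" where
  "subgraph H G \<longleftrightarrow> simple_graph H \<and> verts H \<subseteq> verts G \<and> edges H \<subseteq> edges G"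

definition graph_iso :: "'a ugraph \<Rightarrow> 'b ugraph \<Rightarrow> bool" (infix "\<simeq>" 50) where
  "G \<simeq> H \<longleftrightarrow> (\<exists>f. bij_betw f (verts G) (verts H) \<and>
     (\<forall>u\<in>verts G. \<forall>v\<in>verts G. {u, v} \<in> edges G \<longleftrightarrow> {f u, f v} \<in> edges H))"

definition complete_graph :: "nat \<Rightarrow> nat ugraph" where
  "complete_graph n = UGraph {..<n} {e. e \<subseteq> {..<n} \<and> card e = 2}"

definition triangle_in :: "'a ugraph \<Rightarrow> 'a ugraph \<Rightarrow> bool" where
  "triangle_in T G \<longleftrightarrow> subgraph T G \<and> T \<simeq> complete_graph 3"

definition edge_dominating :: "'a ugraph \<Rightarrow> 'a set set \<Rightarrow> bool" where
  "edge_dominating G F \<longleftrightarrow> F \<subseteq> edges G \<and>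
     (\<forall>e\<in>edges G. e \<in> F \<or> (\<exists>f\<in>F. e \<inter> f \<noteq> {}))"

definition minimal_edge_dominating :: "'a ugraph \<Rightarrow> 'a set set \<Rightarrow> bool" where
  "minimal_edge_dominating G F \<longleftrightarrow>
     edge_dominating G F \<and> (\<forall>F'. F' \<subset> F \<longrightarrow> \<not> edge_dominating G F')"

definition well_edge_dominated :: "'a ugraph \<Rightarrow> bool" where
  "well_edge_dominated G \<longleftrightarrow>
     (\<forall>F F'. minimal_edge_dominating G F \<longrightarrow> minimal_edge_dominating G F' \<longrightarrow> card F = card F')"

definition house :: "nat ugraph" where
  "house = UGraph {1..5} {{1,2}, {2,3}, {3,4}, {4,1}, {3,5}, {4,5}}"

definition dream_house :: "nat ugraph" where
  "dream_house = UGraph {1..7}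
     {{1,2}, {2,3}, {3,4}, {4,1}, {2,5}, {3,6}, {5,6}, {5,7}, {6,7}}"

end

theory Submission
  imports Defs
begin

text \<open>Every maximal matching is a minimal edge dominating set, so all of them have the same size \<open>n\<close>.
  Let \<open>a\<close> and \<open>b\<close> be further neighbours of \<open>x\<close> and \<open>z\<close>. Every maximal matching \<open>N\<close> of
  \<open>G - {x, y, z}\<close> covers \<open>a\<close>, since \<open>N\<close> with \<open>xz\<close> is maximal but would be smaller than \<open>N\<close> with
  \<open>xa\<close> and \<open>zy\<close>. Similar exchanges show that \<open>ab\<close> is an edge, that the remaining neighbours \<open>C\<close>
  of \<open>a\<close> and \<open>D\<close> of \<open>b\<close> form a complete bipartite graph, and that no further vertices occur; thus
  \<open>n\<close> is at most \<open>card C + 2\<close>. Minimal edge dominating sets consisting of a large star and some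
  disjoint edges have \<open>card C + 3\<close> elements, however: a star at \<open>a\<close> exists if \<open>x\<close> has a neighbour in
  \<open>D\<close>, and a star at a vertex of \<open>D\<close> if \<open>D\<close> has a second element. Hence \<open>C\<close> and \<open>D\<close> are both empty
  (the house) or both singletons (the dream house).\<close>

section \<open>Matchings, and maximal matchings avoiding a given vertex set\<close>

definition nbrs :: "'a set set \<Rightarrow> 'a \<Rightarrow> 'a set" where
  "nbrs E v = {w. {v, w} \<in> E}"

definition matching :: "'a set set \<Rightarrow> 'a set set \<Rightarrow> bool" where
  "matching E M \<longleftrightarrow> M \<subseteq> E \<and> pairwise disjnt M"

text \<open>Maximality refers to the graph with \<open>S\<close> deleted, but \<open>E\<close> stays
  unchanged so that edges inside \<open>S\<close> can later be added to \<open>M\<close>.\<close>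

definition max_matching_off :: "'a set set \<Rightarrow> 'a set \<Rightarrow> 'a set set \<Rightarrow> bool" where
  "max_matching_off E S M \<longleftrightarrow>
     matching E M \<and> \<Union>M \<inter> S = {} \<and> (\<forall>e\<in>E. e \<inter> S = {} \<longrightarrow> e \<inter> \<Union>M \<noteq> {})"

lemma matching_empty [simp]: "matching E {}"
  by (simp add: matching_def)

lemma matching_insert:
  "matching E (insert e M)" if "matching E M" "e \<in> E" "e \<inter> \<Union>M = {}"
  using that unfolding matching_def pairwise_insert disjnt_def by blast

lemma matching_Un:
  "matching E (K \<union> M)" if "matching E K" "matching E M" "\<Union>K \<inter> \<Union>M = {}"
proof -
  have "e \<inter> f = {}" if "e \<in> K \<union> M" "f \<in> K \<union> M" "e \<noteq> f" for e f
  proof (cases "(e \<in> K) = (f \<in> K)")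
    case True
    with that \<open>matching E K\<close> \<open>matching E M\<close> show ?thesis
      unfolding matching_def pairwise_def disjnt_def by (metis Un_iff)
  next
    case False
    with that have "e \<inter> f \<subseteq> \<Union>K \<inter> \<Union>M" by blast
    with \<open>\<Union>K \<inter> \<Union>M = {}\<close> show ?thesis by simp
  qed
  with that(1,2) show ?thesis by (simp add: matching_def pairwise_def disjnt_def)
qed

text \<open>Since \<open>E\<close> is finite, some matching containing \<open>M\<close> and avoiding
  \<open>S\<close> is maximal under inclusion; an edge off \<open>S\<close> that it missed could be
  added to it.\<close>

lemma max_matching_off_extend:
  assumes "finite E" "{} \<notin> E" "matching E M" "\<Union>M \<inter> S = {}"
  obtains N where "max_matching_off E S N" "M \<subseteq> N"
proof -
  let ?X = "{N. matching E N \<and> \<Union>N \<inter> S = {}}"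
  have "finite ?X"
    by (rule finite_subset[of _ "Pow E"]) (use assms in \<open>auto simp: matching_def\<close>)
  moreover have "M \<in> ?X" using assms by simp
  ultimately have "\<exists>N\<in>?X. M \<subseteq> N \<and> (\<forall>N'\<in>?X. N \<subseteq> N' \<longrightarrow> N = N')"
    by (rule finite_has_maximal2)
  then obtain N where N: "N \<in> ?X" "M \<subseteq> N" and mx: "\<forall>N'\<in>?X. N \<subseteq> N' \<longrightarrow> N = N'"
    by (elim bexE conjE) (rule that)
  have "e \<inter> \<Union>N \<noteq> {}" if "e \<in> E" "e \<inter> S = {}" for e
  proof
    assume e: "e \<inter> \<Union>N = {}"
    with N that have "insert e N \<in> ?X"
      using matching_insert[of E N e] by (simp add: Int_Un_distrib2)
    with mx have "N \<subseteq> insert e N \<longrightarrow> N = insert e N" by (rule bspec)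
    then have "N = insert e N" by (simp add: subset_insertI)
    then have "e \<in> N" by blast
    with e have "e = {}" by blast
    with that assms show False by blast
  qed
  with N have "max_matching_off E S N"
    unfolding max_matching_off_def by simp
  then show thesis using N(2) by (rule that)
qed

section \<open>Counting with edge sets whose minimal edge dominating sets all have size
  \<open>n\<close>\<close>

locale wed_edges =
  fixes E :: "'a set set" and n :: nat
  assumes finite_E: "finite E"
    and card_edge: "e \<in> E \<Longrightarrow> card e = 2"
    and card_matching_le: "matching E M \<Longrightarrow> card M \<le> n"
    and card_min_eds: "F \<subseteq> E \<Longrightarrow> (\<And>e. e \<in> E \<Longrightarrow> e \<inter> \<Union>F \<noteq> {}) \<Longrightarrow>
      (\<And>f. f \<in> F \<Longrightarrow> \<exists>e\<in>E. e \<inter> \<Union>(F - {f}) = {}) \<Longrightarrow> card F = n"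
begin

lemma not_loop: "{u} \<notin> E"
  using card_edge[of "{u}"] by auto

lemma edge_distinct: "{u, v} \<in> E \<Longrightarrow> u \<noteq> v"
  using not_loop by auto

lemma edgeE:
  assumes "e \<in> E" obtains u v where "e = {u, v}" "u \<noteq> v" "{u, v} \<in> E"
  using card_edge[OF assms] assms by (auto simp: card_2_iff)

lemma edge_atE:
  assumes "e \<in> E" "u \<in> e" obtains v where "e = {u, v}"
  using card_edge[OF assms(1)] assms(2) by (auto simp: card_2_iff)

lemma finite_matching: "matching E M \<Longrightarrow> finite M"
  using finite_E finite_subset by (auto simp: matching_def)

lemma empty_notin_E: "{} \<notin> E"
  using card_edge by force

lemmas extend = max_matching_off_extend[OF finite_E empty_notin_E]

lemma max_matching_off_exists: obtains N where "max_matching_off E S N"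
  by (rule extend[of "{}" S]) auto

lemma card_Un_matching:
  assumes "matching E K" "matching E N" "\<Union>K \<inter> \<Union>N = {}"
  shows "card (K \<union> N) = card K + card N"
proof (rule card_Un_disjoint)
  have "e \<noteq> {}" if "e \<in> K" for e
    using that assms empty_notin_E by (auto simp: matching_def)
  then show "K \<inter> N = {}" using assms(3) by blast
qed (use assms finite_matching in auto)

lemma card_add_le:
  assumes "matching E K" "max_matching_off E S N" "\<Union>K \<inter> \<Union>N = {}"
  shows "card K + card N \<le> n"
  using card_matching_le[OF matching_Un[of E K N]] card_Un_matching[of K N] assms
  by (auto simp: max_matching_off_def)

text \<open>Maximality of \<open>N\<close> takes care of the edges off \<open>S\<close> and
  \<open>touch\<close> of those meeting \<open>S\<close>, so \<open>K \<union> N\<close> dominates.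
  It is minimal because each edge of a matching meets no other edge of it.\<close>

lemma card_maximal:
  assumes off: "max_matching_off E S N" and K: "matching E K" "\<Union>K \<subseteq> S"
    and touch: "\<And>u v. {u, v} \<in> E \<Longrightarrow> u \<in> S \<Longrightarrow> u \<notin> \<Union>K \<Longrightarrow> v \<notin> \<Union>K \<Longrightarrow> v \<in> \<Union>N"
  shows "card K + card N = n"
proof -
  have disj: "\<Union>K \<inter> \<Union>N = {}" and N: "matching E N"
    using off K(2) by (auto simp: max_matching_off_def)
  have m: "matching E (K \<union> N)" using K(1) N disj by (rule matching_Un)
  have "card (K \<union> N) = n"
  proof (rule card_min_eds)
    show "K \<union> N \<subseteq> E" using m by (auto simp: matching_def)
    show "e \<inter> \<Union>(K \<union> N) \<noteq> {}" if "e \<in> E" for e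
    proof (cases "e \<inter> S = {}")
      case True
      with that off show ?thesis unfolding max_matching_off_def by blast
    next
      case False
      then obtain u where u: "u \<in> e" "u \<in> S" by auto
      with edge_atE[OF that] obtain v where "e = {u, v}" by blast
      with touch[of u v] u that show ?thesis by blast
    qed
    show "\<exists>e\<in>E. e \<inter> \<Union>(K \<union> N - {f}) = {}" if "f \<in> K \<union> N" for f
    proof
      show "f \<inter> \<Union>(K \<union> N - {f}) = {}"
        using that m unfolding matching_def pairwise_def disjnt_def by blast
      show "f \<in> E" using that m unfolding matching_def by blast
    qed
  qed
  with card_Un_matching[OF K(1) N disj] show ?thesis by simp
qed

text \<open>The edge \<open>{v, w}\<close> is dominated only by \<open>{s, v}\<close>, and each edge
  of \<open>P\<close> only by itself. Hence the star from \<open>s\<close> to \<open>L\<close>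
  together with \<open>P\<close> is a minimal edge dominating set.\<close>

lemma card_star_eds:
  assumes P: "matching E P" and L: "finite L" "L \<noteq> {}" and s: "s \<notin> L \<union> \<Union>P"
    and disj: "L \<inter> \<Union>P = {}" and star: "\<And>v. v \<in> L \<Longrightarrow> {s, v} \<in> E"
    and cover: "\<And>e. e \<in> E \<Longrightarrow> e \<inter> (insert s L \<union> \<Union>P) \<noteq> {}"
    and w: "w \<notin> insert s L \<union> \<Union>P" "\<And>v. v \<in> L \<Longrightarrow> {v, w} \<in> E"
  shows "card P + card L = n"
proof -
  let ?S = "(\<lambda>v. {s, v}) ` L"
  have U: "\<Union>(P \<union> ?S) = insert s L \<union> \<Union>P" using L(2) by auto
  have "card (P \<union> ?S) = card P + card ?S"
    by (rule card_Un_disjoint) (use P L s finite_matching in auto)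
  moreover have "inj_on (\<lambda>v. {s, v}) L" by (auto simp: inj_on_def doubleton_eq_iff)
  ultimately have "card (P \<union> ?S) = card P + card L" by (simp add: card_image)
  moreover have "card (P \<union> ?S) = n"
  proof (rule card_min_eds)
    show "P \<union> ?S \<subseteq> E" using P star by (auto simp: matching_def)
    show "e \<inter> \<Union>(P \<union> ?S) \<noteq> {}" if "e \<in> E" for e
      unfolding U using cover[OF that] .
    fix f assume "f \<in> P \<union> ?S"
    then consider "f \<in> P" | v where "v \<in> L" "f = {s, v}" by blast
    then show "\<exists>e\<in>E. e \<inter> \<Union>(P \<union> ?S - {f}) = {}"
    proof cases
      case 1
      have "f \<inter> g = {}" if "g \<in> P \<union> ?S - {f}" for g
      proof (cases "g \<in> P")
        case True
        with that 1 P show ?thesis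
          unfolding matching_def pairwise_def disjnt_def by (metis DiffE singletonI)
      next
        case False
        with that 1 s disj show ?thesis by blast
      qed
      then have "f \<inter> \<Union>(P \<union> ?S - {f}) = {}" by blast
      then show ?thesis using 1 P unfolding matching_def by blast
    next
      case 2
      have "v \<notin> g \<and> w \<notin> g" if "g \<in> P \<union> ?S - {f}" for g
        using that 2 s disj w(1) by blast
      then have "{v, w} \<inter> \<Union>(P \<union> ?S - {f}) = {}" by blast
      then show ?thesis using w(2)[OF 2(1)] by (rule rev_bexI[rotated])
    qed
  qed
  ultimately show ?thesis by simp
qed

end

section \<open>Matching exchanges around the triangle\<close>

locale roofed_triangle = wed_edges E n for E :: "'a set set" and n +
  fixes x y z a b :: 'a
  assumes xy: "{x, y} \<in> E" and yz: "{y, z} \<in> E" and xz: "{x, z} \<in> E"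
    and nbr_y: "{y, v} \<in> E \<Longrightarrow> v = x \<or> v = z"
    and triangle: "{u, v} \<in> E \<Longrightarrow> {v, w} \<in> E \<Longrightarrow> {u, w} \<in> E \<Longrightarrow> {u, v, w} = {x, y, z}"
    and xa: "{x, a} \<in> E" and a_notin: "a \<noteq> y" "a \<noteq> z"
    and zb: "{z, b} \<in> E" and b_notin: "b \<noteq> y" "b \<noteq> x"
begin

lemma edges_sym: "{y, x} \<in> E" "{z, y} \<in> E" "{z, x} \<in> E" "{a, x} \<in> E" "{b, z} \<in> E"
  using xy yz xz xa zb by (simp_all add: insert_commute)

text \<open>The configuration is symmetric under exchanging \<open>x\<close> with \<open>z\<close>
  and \<open>a\<close> with \<open>b\<close>. Interpreting the locale along this symmetry carries
  each fact about \<open>D\<close> over to \<open>C\<close> and back.\<close>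

lemma flip: "roofed_triangle E n z y x b a"
proof unfold_locales
  show "{u, v, w} = {z, y, x}" if "{u, v} \<in> E" "{v, w} \<in> E" "{u, w} \<in> E" for u v w
    using triangle[OF that] by (simp add: insert_commute)
  show "v = z \<or> v = x" if "{y, v} \<in> E" for v
    using nbr_y[OF that] by blast
qed (simp_all add: edges_sym a_notin b_notin xa zb)

lemma xyz_distinct: "x \<noteq> y" "y \<noteq> z" "x \<noteq> z" "x \<noteq> a" "z \<noteq> b" "a \<noteq> b"
proof -
  show "x \<noteq> y" "y \<noteq> z" "x \<noteq> z" "x \<noteq> a" "z \<noteq> b"
    using edge_distinct xy yz xz xa zb by blast+
  show "a \<noteq> b"
  proof
    assume "a = b"
    then have "{x, z, a} = {x, y, z}" using triangle xz xa zb by auto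
    then show False using a_notin \<open>x \<noteq> y\<close> \<open>x \<noteq> a\<close> \<open>y \<noteq> z\<close> by auto
  qed
qed

lemmas distinct = xyz_distinct xyz_distinct[symmetric] a_notin b_notin a_notin[symmetric] b_notin[symmetric]

text \<open>Uniqueness of the triangle in the form that excludes edges: one corner outside
  \<open>x\<close>, \<open>y\<close>, \<open>z\<close> suffices.\<close>

lemma triangle_False:
  assumes "{u, v} \<in> E" "{v, w} \<in> E" "{u, w} \<in> E" "u \<noteq> x" "u \<noteq> y" "u \<noteq> z"
  shows False
proof -
  have "u \<in> {x, y, z}" using triangle[OF assms(1-3)] by (rule subst) simp
  with assms(4-6) show False by simp
qed

lemma not_edges: "{a, z} \<notin> E" "{z, a} \<notin> E" "{a, y} \<notin> E" "{y, a} \<notin> E"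
    "{b, x} \<notin> E" "{x, b} \<notin> E" "{b, y} \<notin> E" "{y, b} \<notin> E"
proof -
  show az: "{a, z} \<notin> E" using triangle_False[of a x z] edges_sym xz distinct by auto
  show bx: "{b, x} \<notin> E" using triangle_False[of b z x] edges_sym xz distinct by auto
  show ya: "{y, a} \<notin> E" and yb: "{y, b} \<notin> E" using nbr_y distinct by blast+
  show "{z, a} \<notin> E" "{x, b} \<notin> E" "{a, y} \<notin> E" "{b, y} \<notin> E"
    using az bx ya yb by (simp_all add: insert_commute)
qed

lemma free_vertex_covered:
  assumes "max_matching_off E {x, y, z} N" shows "a \<in> \<Union>N"
proof (rule ccontr)
  assume a: "a \<notin> \<Union>N"
  have N: "\<Union>N \<inter> {x, y, z} = {}" using assms by (auto simp: max_matching_off_def)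
  \<comment> \<open>Only \<open>y\<close> stays uncovered in the triangle, and both its neighbours
    are covered.\<close>
  have "card {{x, z}} + card N = n"
    by (rule card_maximal[OF assms]) (use xz nbr_y distinct in \<open>auto intro!: matching_insert\<close>)
  moreover have "card {{x, a}, {z, y}} + card N \<le> n"
    by (rule card_add_le[OF _ assms])
      (use xa edges_sym distinct a N in \<open>auto intro!: matching_insert\<close>)
  moreover have "card {{x, a}, {z, y}} = 2" using distinct by (simp add: doubleton_eq_iff)
  ultimately show False by simp
qed

text \<open>The edges \<open>xa\<close> and \<open>zb\<close> leave only \<open>y\<close> uncovered
  among the five deleted vertices, so they complete \<open>N\<close> to a maximal matching.\<close>

lemma card_off_base:
  assumes "max_matching_off E {x, y, z, a, b} N" shows "n = card N + 2"
proof -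
  have "card {{x, a}, {z, b}} + card N = n"
    by (rule card_maximal[OF assms]) (use xa zb nbr_y distinct in \<open>auto intro!: matching_insert\<close>)
  moreover have "card {{x, a}, {z, b}} = 2" using distinct by (simp add: doubleton_eq_iff)
  ultimately show ?thesis by simp
qed

section \<open>The further neighbours of \<open>a\<close> and \<open>b\<close>\<close>

abbreviation "C \<equiv> nbrs E a - {x, b}"
abbreviation "D \<equiv> nbrs E b - {z, a}"

lemma D_notin: "D \<inter> {x, y, z, a, b} = {}"
  using not_edges not_loop[of b] distinct by (auto simp: nbrs_def)

lemma C_notin: "C \<inter> {x, y, z, a, b} = {}"
  using not_edges not_loop[of a] distinct by (auto simp: nbrs_def)

lemma in_D: "d \<in> D \<Longrightarrow> {b, d} \<in> E" "d \<in> D \<Longrightarrow> d \<notin> {x, y, z, a, b}"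
  using D_notin by (simp add: nbrs_def, blast)

lemma in_C: "c \<in> C \<Longrightarrow> {a, c} \<in> E" "c \<in> C \<Longrightarrow> c \<notin> {x, y, z, a, b}"
  using C_notin by (simp add: nbrs_def, blast)

text \<open>A missed \<open>d\<close> would allow adding the three edges \<open>xa\<close>,
  \<open>zy\<close> and \<open>bd\<close>, one more than \<open>card_off_base\<close>
  permits.\<close>

lemma D_covered:
  assumes N: "max_matching_off E {x, y, z, a, b} N" shows "D \<subseteq> \<Union>N"
proof (rule ccontr)
  assume "\<not> D \<subseteq> \<Union>N"
  then obtain d where d: "d \<in> D" "d \<notin> \<Union>N" by blast
  note bd = in_D[OF d(1)]
  have off: "\<Union>N \<inter> {x, y, z, a, b} = {}" using N by (auto simp: max_matching_off_def)
  have "card {{x, a}, {z, y}, {b, d}} + card N \<le> n"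
    by (rule card_add_le[OF _ N])
      (use xa edges_sym distinct off bd d(2) in \<open>auto intro!: matching_insert\<close>)
  moreover have "card {{x, a}, {z, y}, {b, d}} = 3"
    using distinct bd by (simp add: doubleton_eq_iff)
  ultimately show False using card_off_base[OF N] by simp
qed

lemma C_covered:
  assumes N: "max_matching_off E {x, y, z, a, b} N" shows "C \<subseteq> \<Union>N"
proof -
  interpret flip: roofed_triangle E n z y x b a by (rule flip)
  show ?thesis using flip.D_covered N by (simp add: insert_commute)
qed

text \<open>If \<open>ab\<close> were missing, all neighbours of \<open>a\<close> and
  \<open>b\<close> outside the triangle would lie in \<open>C\<close> or \<open>D\<close> and so be
  covered by \<open>N\<close>. Then \<open>N\<close> would be maximal off the triangle while missing
  \<open>a\<close>, against \<open>free_vertex_covered\<close>.\<close>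

lemma ab: "{a, b} \<in> E"
proof (rule ccontr)
  assume ab: "{a, b} \<notin> E"
  obtain N where N: "max_matching_off E {x, y, z, a, b} N"
    by (rule max_matching_off_exists)
  have "max_matching_off E {x, y, z} N"
    unfolding max_matching_off_def
  proof (intro conjI ballI impI)
    fix e assume e: "e \<in> E" "e \<inter> {x, y, z} = {}"
    show "e \<inter> \<Union>N \<noteq> {}"
    proof (cases "a \<in> e \<or> b \<in> e")
      case True
      with edge_atE[OF e(1)] obtain u v where "e = {u, v}" "u = a \<or> u = b" by metis
      with e ab have "v \<in> C \<union> D" by (auto simp: nbrs_def insert_commute)
      with C_covered[OF N] D_covered[OF N] \<open>e = {u, v}\<close> show ?thesis by blast
    next
      case False
      with e N show ?thesis by (auto simp: max_matching_off_def)
    qed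
  qed (use N in \<open>auto simp: max_matching_off_def\<close>)
  then have "a \<in> \<Union>N" by (rule free_vertex_covered)
  with N show False by (auto simp: max_matching_off_def)
qed

lemma C_Int_D: "C \<inter> D = {}"
  using triangle_False[of a b] ab distinct by (auto simp: nbrs_def insert_commute)

lemma D_indep: "d \<in> D \<Longrightarrow> d' \<in> D \<Longrightarrow> {d, d'} \<notin> E"
  using triangle_False[of b d d'] distinct by (auto simp: nbrs_def)

text \<open>If \<open>N\<close> covered \<open>D\<close>, both \<open>ac\<close>, \<open>xy\<close>,
  \<open>zb\<close> and \<open>ac\<close>, \<open>xz\<close> would complete it to a maximal
  matching, giving two different sizes.\<close>

lemma exposes_D:
  assumes c: "c \<in> C" and N: "max_matching_off E {x, y, z, a, b, c} N"
  obtains d where "d \<in> D" "d \<notin> \<Union>N"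
proof (rule ccontr)
  assume "\<not> thesis"
  with that have D: "D \<subseteq> \<Union>N" by blast
  note ac = in_C[OF c]
  have nb: "v = z \<or> v = a \<or> v \<in> D" if "{b, v} \<in> E" for v
    using that by (auto simp: nbrs_def)
  have "card {{a, c}, {x, y}, {z, b}} + card N = n"
    by (rule card_maximal[OF N]) (use xy zb ac distinct in \<open>auto intro!: matching_insert\<close>)
  moreover have "card {{a, c}, {x, y}, {z, b}} = 3"
    using distinct ac by (simp add: doubleton_eq_iff)
  \<comment> \<open>The shorter completion leaves \<open>y\<close> and \<open>b\<close> uncovered;
    the neighbours of \<open>b\<close> are \<open>z\<close>, \<open>a\<close> and the vertices of
    \<open>D\<close>, all covered.\<close>
  moreover have "card {{a, c}, {x, z}} + card N = n"
  proof (rule card_maximal[OF N])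
    fix u v
    assume uv: "{u, v} \<in> E" "u \<in> {x, y, z, a, b, c}" "u \<notin> \<Union>{{a, c}, {x, z}}" "v \<notin> \<Union>{{a, c}, {x, z}}"
    then have "u = y \<or> u = b" by auto
    with uv nbr_y[of v] nb[of v] D show "v \<in> \<Union>N" by blast
  qed (use xz ac distinct in \<open>auto intro!: matching_insert\<close>)
  moreover have "card {{a, c}, {x, z}} = 2"
    using distinct ac by (simp add: doubleton_eq_iff)
  ultimately show False by simp
qed

text \<open>Dropping \<open>cw\<close> and extending again away from \<open>c\<close> exposes some
  \<open>d\<close> in \<open>D\<close>. As \<open>M\<close> covers \<open>d\<close>, the dropped
  edge contains it, and \<open>d\<close> differs from \<open>c\<close>.\<close>

lemma C_matched_to_D:
  assumes M: "max_matching_off E {x, y, z, a, b} M" and cw: "{c, w} \<in> M" and c: "c \<in> C"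
  shows "w \<in> D"
proof -
  have m: "matching E M" using M by (simp add: max_matching_off_def)
  let ?M = "M - {{c, w}}"
  have "c \<notin> \<Union>?M" using m cw by (fastforce simp: matching_def pairwise_def disjnt_def)
  then have "\<Union>?M \<inter> {x, y, z, a, b, c} = {}" using M by (fastforce simp: max_matching_off_def)
  moreover have "matching E ?M" using m by (auto simp: matching_def pairwise_def)
  ultimately obtain N where N: "max_matching_off E {x, y, z, a, b, c} N" "?M \<subseteq> N"
    using extend by metis
  then obtain d where d: "d \<in> D" "d \<notin> \<Union>N" using exposes_D[OF c] by blast
  moreover have "d \<in> \<Union>M" using d D_covered[OF M] by blast
  ultimately have "d \<in> {c, w}" using N(2) by blast
  then show ?thesis using d c C_Int_D by blast
qed

text \<open>Adjacency to \<open>x\<close> or \<open>b\<close> would close a second triangle through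
  \<open>a\<close>, and \<open>y\<close> has no neighbours but \<open>x\<close> and
  \<open>z\<close>. For \<open>w\<close> off the five base vertices, the edge \<open>cw\<close>
  extends to a matching to which \<open>C_matched_to_D\<close> applies.\<close>

lemma nbr_C:
  assumes c: "c \<in> C" and cw: "{c, w} \<in> E"
  shows "w = a \<or> w = z \<or> w \<in> D"
proof (cases "w \<in> {x, y, z, a, b}")
  case True
  have "{a, c} \<in> E" "c \<noteq> x" "c \<noteq> y" "c \<noteq> z" using in_C[OF c] by auto
  with triangle_False[of a c x] triangle_False[of a c b] nbr_y[of c] cw xa ab distinct True
  show ?thesis by (auto simp: insert_commute)
next
  case False
  have "c \<notin> {x, y, z, a, b}" using c C_notin by blast
  with False have "\<Union>{{c, w}} \<inter> {x, y, z, a, b} = {}" by auto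
  moreover have "matching E {{c, w}}" using cw by (auto intro: matching_insert)
  ultimately obtain M where "max_matching_off E {x, y, z, a, b} M" "{{c, w}} \<subseteq> M"
    using extend by metis
  with C_matched_to_D c show ?thesis by blast
qed

lemma nbr_D:
  assumes "d \<in> D" "{d, w} \<in> E"
  shows "w = b \<or> w = x \<or> w \<in> C"
proof -
  interpret flip: roofed_triangle E n z y x b a by (rule flip)
  show ?thesis using flip.nbr_C assms by blast
qed

text \<open>Completing \<open>N\<close> by \<open>ac\<close>, \<open>bd\<close>, \<open>xz\<close>
  shows that \<open>n\<close> is \<open>card N + 3\<close>, while an extension \<open>M\<close> of
  \<open>N\<close> off the base has \<open>n - 2\<close> edges, just one more than \<open>N\<close>.
  That single edge has to cover both \<open>c\<close> and \<open>d\<close>.\<close>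

lemma C_D_complete:
  assumes c: "c \<in> C" and d: "d \<in> D" shows "{c, d} \<in> E"
proof -
  have c': "{a, c} \<in> E" "c \<notin> {x, y, z, a, b}" and d': "{b, d} \<in> E" "d \<notin> {x, y, z, a, b}"
    using in_C[OF c] in_D[OF d] by auto
  have cd: "c \<noteq> d" using c d C_Int_D by blast
  obtain N where N: "max_matching_off E {x, y, z, a, b, c, d} N"
    by (rule max_matching_off_exists)
  then have off: "\<Union>N \<inter> {x, y, z, a, b, c, d} = {}" and mN: "matching E N"
    by (auto simp: max_matching_off_def)
  have "card {{a, c}, {b, d}, {x, z}} + card N = n"
  proof (rule card_maximal[OF N])
    fix u v
    assume uv: "{u, v} \<in> E" "u \<in> {x, y, z, a, b, c, d}" "u \<notin> \<Union>{{a, c}, {b, d}, {x, z}}"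
      "v \<notin> \<Union>{{a, c}, {b, d}, {x, z}}"
    then have "u = y" by auto
    with uv nbr_y[of v] show "v \<in> \<Union>N" by blast
  qed (use xz c' d' cd distinct in \<open>auto intro!: matching_insert\<close>)
  moreover have "card {{a, c}, {b, d}, {x, z}} = 3"
    using distinct c' d' cd by (simp add: doubleton_eq_iff)
  ultimately have cardN: "n = card N + 3" by simp
  have "\<Union>N \<inter> {x, y, z, a, b} = {}" using off by blast
  then obtain M where M: "max_matching_off E {x, y, z, a, b} M" "N \<subseteq> M"
    using extend mN by metis
  then have mM: "matching E M" by (simp add: max_matching_off_def)
  from M c d obtain e f where ef: "e \<in> M" "c \<in> e" "f \<in> M" "d \<in> f"
    using C_covered[OF M(1)] D_covered[OF M(1)] by blast
  have "e = f"
  proof (rule ccontr)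
    assume "e \<noteq> f"
    moreover have "e \<notin> N" "f \<notin> N" using off ef by auto
    ultimately have "card (insert e (insert f N)) = card N + 2"
      using finite_matching[OF mN] by simp
    moreover have "card (insert e (insert f N)) \<le> card M"
      using M ef finite_matching[OF mM] by (intro card_mono) auto
    ultimately show False using cardN card_off_base[OF M(1)] by simp
  qed
  moreover have "card e = 2" "e \<in> E" using ef mM card_edge by (auto simp: matching_def)
  ultimately have "e = {c, d}" using ef cd by (auto simp: card_2_iff)
  with \<open>e \<in> E\<close> show ?thesis by simp
qed

text \<open>By \<open>exposes_D\<close> an element of \<open>C\<close> yields one of
  \<open>D\<close>; the mirror image gives the converse.\<close>

lemma C_empty_iff: "C = {} \<longleftrightarrow> D = {}"
proof -
  interpret flip: roofed_triangle E n z y x b a by (rule flip)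
  show ?thesis
    using exposes_D flip.exposes_D max_matching_off_exists by (metis all_not_in_conv)
qed

text \<open>A neighbour \<open>v\<close> of \<open>x\<close> other than \<open>y\<close> and
  \<open>z\<close> can take the role of \<open>a\<close>, so \<open>ab\<close> makes it adjacent to
  \<open>b\<close>.\<close>

lemma nbr_x:
  assumes "{x, v} \<in> E" shows "v = y \<or> v = z \<or> v = a \<or> v \<in> D"
proof (cases "v = y \<or> v = z")
  case False
  then interpret v: roofed_triangle E n x y z v b
  proof unfold_locales
    show "{u, v, w} = {x, y, z}" if "{u, v} \<in> E" "{v, w} \<in> E" "{u, w} \<in> E" for u v w
      using that by (rule triangle)
  qed (use assms xy yz xz nbr_y zb b_notin in simp_all)
  show ?thesis using v.ab False by (auto simp: nbrs_def insert_commute)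
qed auto

lemma nbr_z:
  assumes "{z, v} \<in> E" shows "v = y \<or> v = x \<or> v = b \<or> v \<in> C"
proof -
  interpret flip: roofed_triangle E n z y x b a by (rule flip)
  show ?thesis using flip.nbr_x assms by blast
qed

text \<open>Prepares the use of connectedness, by which closure under adjacency rules out any
  further vertex.\<close>

lemma base_closed:
  assumes u: "u \<in> {x, y, z, a, b} \<union> C \<union> D" and uv: "{u, v} \<in> E"
  shows "v \<in> {x, y, z, a, b} \<union> C \<union> D"
proof -
  consider "u = x" | "u = y" | "u = z" | "u = a" | "u = b" | "u \<in> C" | "u \<in> D" using u by blast
  then show ?thesis
  proof cases
    case 1 with uv nbr_x[of v] show ?thesis by blast
  next
    case 2 with uv nbr_y[of v] show ?thesis by blast
  next
    case 3 with uv nbr_z[of v] show ?thesis by blast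
  next
    case 4 with uv show ?thesis by (auto simp: nbrs_def)
  next
    case 5 with uv show ?thesis by (auto simp: nbrs_def)
  next
    case 6 with uv nbr_C[of u v] show ?thesis by blast
  next
    case 7 with uv nbr_D[of u v] show ?thesis by blast
  qed
qed

end

section \<open>Star counts bounding \<open>C\<close> and \<open>D\<close>, and the resulting edge
  sets\<close>

locale roofed_triangle_spanning = roofed_triangle +
  assumes spanning: "\<Union>E \<subseteq> {x, y, z, a, b} \<union> C \<union> D"
begin

lemma flip_spanning: "roofed_triangle_spanning E n z y x b a"
proof -
  interpret flip: roofed_triangle E n z y x b a by (rule flip)
  show ?thesis by unfold_locales (use spanning in auto)
qed

lemma finite_C: "finite C"
proof (rule finite_subset)
  show "C \<subseteq> \<Union>E" by (auto simp: nbrs_def)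
  have "finite e" if "e \<in> E" for e using card_edge[OF that] by (simp add: card_ge_0_finite)
  then show "finite (\<Union>E)" using finite_E by blast
qed

text \<open>As \<open>D\<close> is independent, each edge of a matching off the base has an end in
  \<open>C\<close>, and distinct edges have distinct ends.\<close>

lemma n_le: "n \<le> card C + 2"
proof -
  obtain M where M: "max_matching_off E {x, y, z, a, b} M"
    by (rule max_matching_off_exists)
  then have m: "matching E M" and off: "\<Union>M \<inter> {x, y, z, a, b} = {}"
    by (auto simp: max_matching_off_def)
  have "card M \<le> card C"
  proof (rule card_le_if_inj_on_rel[where r = "\<lambda>e c. c \<in> e"])
    fix e assume e: "e \<in> M"
    then have "e \<in> E" using m by (auto simp: matching_def)
    with edgeE obtain u v where uv: "e = {u, v}" "{u, v} \<in> E" by metis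
    then have "u \<in> C \<union> D" "v \<in> C \<union> D" using spanning off e by blast+
    with uv D_indep have "u \<in> C \<or> v \<in> C" by blast
    with uv show "\<exists>c. c \<in> C \<and> c \<in> e" by auto
  next
    fix e f c assume "e \<in> M" "f \<in> M" "c \<in> e" "c \<in> f"
    with m show "e = f" by (auto simp: matching_def pairwise_def disjnt_def)
  qed (rule finite_C)
  with card_off_base[OF M] show ?thesis by simp
qed

lemma covers:
  assumes "e \<in> E" "{x, y, z, a, b} \<union> C \<subseteq> W" shows "e \<inter> W \<noteq> {}"
proof
  assume "e \<inter> W = {}"
  obtain u v where uv: "e = {u, v}" "{u, v} \<in> E" using edgeE[OF assms(1)] by metis
  then have "u \<in> D" "v \<in> D" using spanning assms \<open>e \<inter> W = {}\<close> by blast+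
  with uv D_indep show False by blast
qed

text \<open>If \<open>xd\<close> were an edge, \<open>x\<close>, \<open>b\<close> and all of
  \<open>C\<close> would be common neighbours of \<open>a\<close> and \<open>d\<close>. The star
  from \<open>a\<close> to them together with \<open>yz\<close> would have \<open>card C + 3\<close>
  edges, with \<open>d\<close> as the outside vertex \<open>w\<close>.\<close>

lemma x_D_nonadjacent:
  assumes d: "d \<in> D" shows "{x, d} \<notin> E"
proof
  assume xd: "{x, d} \<in> E"
  have d': "d \<notin> {x, y, z, a, b}" "d \<notin> C" using in_D[OF d] d C_Int_D by blast+
  have C': "x \<notin> C" "y \<notin> C" "z \<notin> C" "a \<notin> C" "b \<notin> C" using C_notin by blast+
  let ?L = "insert x (insert b C)"
  have "card {{y, z}} + card ?L = n"
  proof (rule card_star_eds)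
    show "matching E {{y, z}}" using yz by (simp add: matching_def)
    show "finite ?L" using finite_C by simp
    show "a \<notin> ?L \<union> \<Union>{{y, z}}" using C'(4) distinct by blast
    show "?L \<inter> \<Union>{{y, z}} = {}" using C'(2,3) distinct by blast
    show "{a, v} \<in> E" if "v \<in> ?L" for v
      using that edges_sym ab in_C(1)[of v] by blast
    show "e \<inter> (insert a ?L \<union> \<Union>{{y, z}}) \<noteq> {}" if "e \<in> E" for e
      by (rule covers[OF that]) blast
    show "d \<notin> insert a ?L \<union> \<Union>{{y, z}}" using d' by blast
    show "{v, d} \<in> E" if "v \<in> ?L" for v
      using that xd in_D(1)[OF d] C_D_complete[OF _ d, of v] by blast
  qed blast
  moreover have "card ?L = card C + 2"
    using card_insert_disjoint[OF finite_C C'(5)] card_insert_disjoint[of "insert b C" x]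
      finite_C C'(1) distinct by simp
  ultimately show False using n_le by simp
qed

text \<open>Two vertices of \<open>D\<close> have \<open>b\<close> and all of \<open>C\<close> as
  common neighbours. The star from \<open>d\<close> to these together with \<open>xa\<close> and
  \<open>yz\<close> would have \<open>card C + 3\<close> edges, with \<open>d'\<close> as the
  outside vertex.\<close>

lemma D_unique:
  assumes d: "d \<in> D" "d' \<in> D" shows "d = d'"
proof (rule ccontr)
  assume neq: "d \<noteq> d'"
  have d': "d \<notin> {x, y, z, a, b}" "d \<notin> C" "d' \<notin> {x, y, z, a, b}" "d' \<notin> C"
    using in_D[OF d(1)] in_D[OF d(2)] d C_Int_D by blast+
  have C': "x \<notin> C" "y \<notin> C" "z \<notin> C" "a \<notin> C" "b \<notin> C" using C_notin by blast+
  let ?P = "{{x, a}, {y, z}}"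
  have "card ?P + card (insert b C) = n"
  proof (rule card_star_eds)
    show "matching E ?P"
      using matching_insert[of E "{{y, z}}" "{x, a}"] xa yz distinct by (simp add: matching_def)
    show "finite (insert b C)" using finite_C by simp
    show "d \<notin> insert b C \<union> \<Union>?P" using d' by blast
    show "insert b C \<inter> \<Union>?P = {}" using C' distinct by blast
    show "{d, v} \<in> E" if "v \<in> insert b C" for v
      using that in_D(1)[OF d(1)] C_D_complete[OF _ d(1), of v] insert_commute[of d v "{}"] by auto
    show "e \<inter> (insert d (insert b C) \<union> \<Union>?P) \<noteq> {}" if "e \<in> E" for e
      by (rule covers[OF that]) blast
    show "d' \<notin> insert d (insert b C) \<union> \<Union>?P" using d' neq by blast
    show "{v, d'} \<in> E" if "v \<in> insert b C" for v
      using that in_D(1)[OF d(2)] C_D_complete[OF _ d(2), of v] by blast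
  qed blast
  moreover have "card (insert b C) = card C + 1"
    using card_insert_disjoint[OF finite_C C'(5)] by simp
  moreover have "card ?P = 2" using distinct by (simp add: doubleton_eq_iff)
  ultimately show False using n_le by simp
qed

lemma x_nbrs: "{x, v} \<in> E \<Longrightarrow> v = y \<or> v = z \<or> v = a"
  using nbr_x[of v] x_D_nonadjacent[of v] by blast

lemma a_nbrs: "{a, v} \<in> E \<Longrightarrow> v = x \<or> v = b \<or> v \<in> C"
  by (auto simp: nbrs_def)

lemma d_nbrs: "d \<in> D \<Longrightarrow> {d, v} \<in> E \<Longrightarrow> v = b \<or> v \<in> C"
  using nbr_D[of d v] x_D_nonadjacent[of d] insert_commute[of d x "{}"] by auto

text \<open>The six edges listed first form the house; the other kinds occur only when
  \<open>C\<close> or \<open>D\<close> is nonempty.\<close>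

lemma edge_cases:
  assumes "e \<in> E"
  shows "e \<in> {{b, a}, {a, x}, {x, z}, {z, b}, {x, y}, {z, y}} \<or> (\<exists>c\<in>C. e = {c, a}) \<or>
    (\<exists>d\<in>D. e = {b, d}) \<or> (\<exists>d\<in>D. \<exists>c\<in>C. e = {d, c})"
proof -
  interpret flip: roofed_triangle_spanning E n z y x b a by (rule flip_spanning)
  obtain u v where e: "e = {u, v}" "{u, v} \<in> E" using edgeE[OF assms] by metis
  then have e': "e = {v, u}" by (simp add: insert_commute)
  have "u \<in> {x, y, z, a, b} \<union> C \<union> D" using spanning e by blast
  then consider "u = x" | "u = y" | "u = z" | "u = a" | "u = b" | "u \<in> C" | "u \<in> D" by blast
  then show ?thesis
  proof cases
    case 1
    with e x_nbrs[of v] consider "e = {x, y}" | "e = {x, z}" | "v = a" by blast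
    then show ?thesis by cases (simp_all add: e' 1)
  next
    case 2
    with e nbr_y[of v] consider "v = x" | "v = z" by blast
    then show ?thesis by cases (simp_all add: e' 2)
  next
    case 3
    with e flip.x_nbrs[of v] consider "v = y" | "v = x" | "v = b" by blast
    then show ?thesis by cases (simp add: e 3, simp add: e' 3, simp add: e 3)
  next
    case 4
    with e a_nbrs[of v] consider "v = x" | "v = b" | "v \<in> C" by blast
    then show ?thesis
    proof cases
      case 1 then show ?thesis by (simp add: e 4)
    next
      case 2 then show ?thesis by (simp add: e' 4)
    next
      case 3
      then have "\<exists>c\<in>C. e = {c, a}" using e' 4 by (intro bexI[of _ v]) simp_all
      then show ?thesis by iprover
    qed
  next
    case 5
    with e flip.a_nbrs[of v] consider "v = z" | "v = a" | "v \<in> D" by blast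
    then show ?thesis
    proof cases
      case 1 then show ?thesis by (simp add: e' 5)
    next
      case 2 then show ?thesis by (simp add: e 5)
    next
      case 3
      then have "\<exists>d\<in>D. e = {b, d}" using e 5 by (intro bexI[of _ v]) simp_all
      then show ?thesis by iprover
    qed
  next
    case 6
    with e flip.d_nbrs[of u v] consider "v = a" | "v \<in> D" by blast
    then show ?thesis
    proof cases
      case 1
      then have "\<exists>c\<in>C. e = {c, a}" using e 6 by (intro bexI[of _ u]) simp_all
      then show ?thesis by iprover
    next
      case 2
      then have "\<exists>d\<in>D. \<exists>c\<in>C. e = {d, c}"
        using e' 6 by (intro bexI[of _ v] bexI[of _ u]) simp_all
      then show ?thesis by iprover
    qed
  next
    case 7
    with e d_nbrs[of u v] consider "v = b" | "v \<in> C" by blast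
    then show ?thesis
    proof cases
      case 1
      then have "\<exists>d\<in>D. e = {b, d}" using e' 7 by (intro bexI[of _ u]) simp_all
      then show ?thesis by iprover
    next
      case 2
      then have "\<exists>d\<in>D. \<exists>c\<in>C. e = {d, c}"
        using e 7 by (intro bexI[of _ u] bexI[of _ v]) simp_all
      then show ?thesis by iprover
    qed
  qed
qed

lemma house_edges:
  assumes "D = {}"
  shows "E = {{b, a}, {a, x}, {x, z}, {z, b}, {x, y}, {z, y}}"
proof
  have "C = {}" using assms C_empty_iff by blast
  then show "E \<subseteq> {{b, a}, {a, x}, {x, z}, {z, b}, {x, y}, {z, y}}"
    using edge_cases assms by (intro subsetI) (simp only: bex_empty simp_thms)
  show "{{b, a}, {a, x}, {x, z}, {z, b}, {x, y}, {z, y}} \<subseteq> E"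
    using edges_sym xy xz zb ab insert_commute[of b a "{}"] by simp
qed

text \<open>\<open>D_unique\<close> and its mirror image make both sets singletons. The edges follow
  the order in \<open>dream_house\<close>, with \<open>c\<close>, \<open>a\<close>,
  \<open>b\<close>, \<open>d\<close>, \<open>x\<close>, \<open>z\<close>, \<open>y\<close> as
  vertices 1 to 7.\<close>

lemma dream_house_edges:
  assumes "D \<noteq> {}"
  obtains c d where "C = {c}" "D = {d}"
    "E = {{c, a}, {a, b}, {b, d}, {d, c}, {a, x}, {b, z}, {x, z}, {x, y}, {z, y}}"
proof -
  interpret flip: roofed_triangle_spanning E n z y x b a by (rule flip_spanning)
  obtain d where d: "d \<in> D" using assms by blast
  obtain c where c: "c \<in> C" using assms C_empty_iff by blast
  have D: "D = {d}" using d D_unique[OF d] by blast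
  have C: "C = {c}" using c flip.D_unique[OF c] by blast
  have "E = {{c, a}, {a, b}, {b, d}, {d, c}, {a, x}, {b, z}, {x, z}, {x, y}, {z, y}}"
  proof
    show "E \<subseteq> {{c, a}, {a, b}, {b, d}, {d, c}, {a, x}, {b, z}, {x, z}, {x, y}, {z, y}}"
    proof
      fix e assume "e \<in> E"
      from edge_cases[OF this]
      show "e \<in> {{c, a}, {a, b}, {b, d}, {d, c}, {a, x}, {b, z}, {x, z}, {x, y}, {z, y}}"
        unfolding C D insert_iff empty_iff bex_simps simp_thms
          insert_commute[of b a "{}"] insert_commute[of z b "{}"]
        by (elim disjE) (simp only: simp_thms)+
    qed
    show "{{c, a}, {a, b}, {b, d}, {d, c}, {a, x}, {b, z}, {x, z}, {x, y}, {z, y}} \<subseteq> E"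
      using edges_sym xy xz ab in_C(1)[OF c] in_D(1)[OF d] C_D_complete[OF c d]
        insert_commute[of c a "{}"] insert_commute[of c d "{}"] by simp
  qed
  with C D show thesis by (rule that)
qed

end

section \<open>Isomorphisms, and the passage from graphs to edge sets\<close>

lemma graph_isoI:
  assumes E: "\<And>e. e \<in> edges G \<Longrightarrow> e \<subseteq> verts G" and f: "inj_on f (verts G)"
    and "f ` verts G = verts H" "(`) f ` edges G = edges H"
  shows "G \<simeq> H"
  unfolding graph_iso_def
proof (intro exI[of _ f] conjI ballI)
  show "bij_betw f (verts G) (verts H)" using assms by (simp add: bij_betw_def)
  fix u v assume uv: "u \<in> verts G" "v \<in> verts G"
  \<comment> \<open>Injectivity on sets of vertices makes \<open>f\<close> reflect edges as well as
    preserve them.\<close>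
  have "f ` {u, v} \<in> (`) f ` edges G \<longleftrightarrow> {u, v} \<in> edges G"
    by (rule inj_on_image_mem_iff[OF inj_on_image_Pow[OF f]]) (use uv E in auto)
  then show "{u, v} \<in> edges G \<longleftrightarrow> {f u, f v} \<in> edges H" using assms(4) by simp
qed

text \<open>Turns three pairwise adjacent vertices into a triangle subgraph, to which the uniqueness
  hypothesis applies.\<close>

lemma triangle_inI:
  assumes G: "simple_graph G" and e: "{u, v} \<in> edges G" "{v, w} \<in> edges G" "{u, w} \<in> edges G"
  shows "triangle_in (UGraph {u, v, w} {{u, v}, {v, w}, {u, w}}) G"
proof -
  have ne: "u \<noteq> v" "v \<noteq> w" "u \<noteq> w" and sub: "{u, v, w} \<subseteq> verts G"
    using G e unfolding simple_graph_def by fastforce+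
  let ?T = "UGraph {u, v, w} {{u, v}, {v, w}, {u, w}}"
  \<comment> \<open>The default value 0 is the label of \<open>u\<close>.\<close>
  let ?f = "(\<lambda>_. 0)(v := 1, w := 2) :: 'a \<Rightarrow> nat"
  have "e \<in> {{0, 1}, {1, 2}, {0, 2}}" if e: "e \<subseteq> {..<3}" "card e = 2" for e :: "nat set"
  proof -
    obtain i j where "e = {i, j}" "i < j"
      using e(2) by (metis card_2_iff insert_commute linorder_neqE_nat)
    with e(1) show ?thesis by (auto simp: numeral_3_eq_3 less_Suc_eq)
  qed
  moreover have "card e = 2 \<and> e \<subseteq> {..<3}" if "e \<in> {{0, 1}, {1, 2}, {0, 2}}" for e :: "nat set"
    using that by auto
  ultimately have K3: "edges (complete_graph 3) = {{0, 1}, {1, 2}, {0, 2}}"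
    unfolding complete_graph_def ugraph.sel by blast
  have "?T \<simeq> complete_graph 3"
  proof (rule graph_isoI[where f = ?f])
    show "?f ` verts ?T = verts (complete_graph 3)"
      using ne by (auto simp: complete_graph_def)
    show "(`) ?f ` edges ?T = edges (complete_graph 3)"
      unfolding K3 using ne by simp
  qed (use ne in \<open>auto simp: inj_on_def\<close>)
  moreover have "subgraph ?T G"
    using ne sub e by (simp add: subgraph_def simple_graph_def)
  ultimately show ?thesis by (simp add: triangle_in_def)
qed

text \<open>A proper subset of \<open>F\<close> lacks some \<open>f\<close>, and the edge that
  \<open>priv\<close> provides for \<open>f\<close> is then undominated.\<close>

lemma minimal_edge_dominatingI:
  assumes "simple_graph G" and F: "F \<subseteq> edges G"
    and cover: "\<And>e. e \<in> edges G \<Longrightarrow> e \<inter> \<Union>F \<noteq> {}"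
    and priv: "\<And>f. f \<in> F \<Longrightarrow> \<exists>e\<in>edges G. e \<inter> \<Union>(F - {f}) = {}"
  shows "minimal_edge_dominating G F"
  unfolding minimal_edge_dominating_def
proof (intro conjI allI impI notI)
  show "edge_dominating G F"
    unfolding edge_dominating_def using F cover by blast
  fix F' assume F': "F' \<subset> F" "edge_dominating G F'"
  then obtain f where f: "f \<in> F" "f \<notin> F'" by blast
  with priv obtain e where e: "e \<in> edges G" "e \<inter> \<Union>(F - {f}) = {}" by blast
  have "e \<noteq> {}" using assms(1) e(1) by (auto simp: simple_graph_def)
  moreover have "e \<in> F' \<or> (\<exists>g\<in>F'. e \<inter> g \<noteq> {})"
    using F'(2) e(1) by (simp add: edge_dominating_def)
  ultimately show False using e(2) F'(1) f by blast
qed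

text \<open>The size of any maximal matching serves as \<open>n\<close>, as such a matching is a
  minimal edge dominating set. Every matching extends to a maximal one, which gives the bound on its
  size.\<close>

lemma well_edge_dominated_imp_wed_edges:
  assumes G: "simple_graph G" and wed: "well_edge_dominated G"
  obtains n where "wed_edges (edges G) n"
proof -
  have fin: "finite (edges G)"
    using G by (auto simp: simple_graph_def intro: finite_subset[of _ "Pow (verts G)"])
  have ne: "{} \<notin> edges G" using G by (auto simp: simple_graph_def)
  have max: "minimal_edge_dominating G N" if N: "max_matching_off (edges G) {} N" for N
  proof (rule minimal_edge_dominatingI[OF G])
    show NE: "N \<subseteq> edges G" using N by (simp add: max_matching_off_def matching_def)
    show "e \<inter> \<Union>N \<noteq> {}" if "e \<in> edges G" for e
      using N that unfolding max_matching_off_def by blast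
    fix f assume f: "f \<in> N"
    have "f \<inter> g = {}" if "g \<in> N - {f}" for g
      using N that f unfolding max_matching_off_def matching_def pairwise_def disjnt_def
      by (metis DiffE singletonI)
    then show "\<exists>e\<in>edges G. e \<inter> \<Union>(N - {f}) = {}"
      using NE f by (intro bexI[of _ f]) auto
  qed
  obtain N where N: "max_matching_off (edges G) {} N"
    by (rule max_matching_off_extend[OF fin ne matching_empty, of "{}"]) auto
  have "wed_edges (edges G) (card N)"
  proof
    fix M assume M: "matching (edges G) M"
    obtain N' where N': "max_matching_off (edges G) {} N'" "M \<subseteq> N'"
      by (rule max_matching_off_extend[OF fin ne M, of "{}"]) auto
    have "finite N'" using N'(1) fin
      by (auto simp: max_matching_off_def matching_def intro: finite_subset)
    then have "card M \<le> card N'" using N'(2) by (rule card_mono)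
    also have "card N' = card N"
      using wed max[OF N] max[OF N'(1)] unfolding well_edge_dominated_def by blast
    finally show "card M \<le> card N" .
  next
    fix F assume "F \<subseteq> edges G" "\<And>e. e \<in> edges G \<Longrightarrow> e \<inter> \<Union>F \<noteq> {}"
      "\<And>f. f \<in> F \<Longrightarrow> \<exists>e\<in>edges G. e \<inter> \<Union>(F - {f}) = {}"
    then have "minimal_edge_dominating G F" by (rule minimal_edge_dominatingI[OF G])
    then show "card F = card N"
      using wed max[OF N] unfolding well_edge_dominated_def by blast
  qed (use fin G in \<open>auto simp: simple_graph_def\<close>)
  then show thesis by (rule that)
qed

text \<open>The edges \<open>vp\<close> and \<open>vq\<close> account for at most two of the edges
  at \<open>v\<close>.\<close>

lemma third_neighbour:
  assumes "simple_graph G" "degree G v \<ge> 3"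
  obtains w where "{v, w} \<in> edges G" "w \<noteq> p" "w \<noteq> q"
proof -
  have "\<not> {e \<in> edges G. v \<in> e} \<subseteq> {{v, p}, {v, q}}"
  proof
    assume "{e \<in> edges G. v \<in> e} \<subseteq> {{v, p}, {v, q}}"
    then have "degree G v \<le> card {{v, p}, {v, q}}"
      unfolding degree_def by (intro card_mono) simp_all
    also have "\<dots> \<le> 2" by (simp add: card_insert_if)
    finally show False using assms(2) by simp
  qed
  then obtain e where e: "e \<in> edges G" "v \<in> e" "e \<noteq> {v, p}" "e \<noteq> {v, q}" by blast
  moreover have "card e = 2" using assms(1) e(1) by (simp add: simple_graph_def)
  ultimately obtain w where "e = {v, w}" by (auto simp: card_2_iff)
  with e show thesis by (intro that[of w]) auto
qed

theorem theorem8: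
  fixes G :: "'a ugraph" and x y z :: 'a
  assumes "simple_graph G"
    and "connected_graph G"
    and "well_edge_dominated G"
    and "\<exists>!T. triangle_in T G"
    and "triangle_in (UGraph {x, y, z} {{x, y}, {y, z}, {x, z}}) G"
    and "degree G y = 2"
    and "degree G x \<ge> 3"
    and "degree G z \<ge> 3"
  shows "G \<simeq> house \<or> G \<simeq> dream_house"
proof -
  let ?E = "edges G"
  note G = assms(1)
  have edges: "{x, y} \<in> ?E" "{y, z} \<in> ?E" "{x, z} \<in> ?E"
    using assms(5) by (simp_all add: triangle_in_def subgraph_def)
  obtain n where "wed_edges ?E n"
    using well_edge_dominated_imp_wed_edges[OF G assms(3)] .
  then interpret wed_edges ?E n .
  have ne: "x \<noteq> y" "y \<noteq> z" "x \<noteq> z" using edges edge_distinct by blast+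
  obtain a where a: "{x, a} \<in> ?E" "a \<noteq> y" "a \<noteq> z"
    by (rule third_neighbour[OF G assms(7)])
  obtain b where b: "{z, b} \<in> ?E" "b \<noteq> y" "b \<noteq> x"
    by (rule third_neighbour[OF G assms(8)])
  \<comment> \<open>Degree 2 leaves no edge at \<open>y\<close> besides the two in the
    triangle.\<close>
  have "{{x, y}, {y, z}} = {e \<in> ?E. y \<in> e}"
  proof (rule card_subset_eq)
    show "finite {e \<in> ?E. y \<in> e}" using finite_E by simp
    show "{{x, y}, {y, z}} \<subseteq> {e \<in> ?E. y \<in> e}" using edges by simp
    show "card {{x, y}, {y, z}} = card {e \<in> ?E. y \<in> e}"
      using assms(6) ne by (simp add: degree_def doubleton_eq_iff)
  qed
  then have "{y, v} \<in> {{x, y}, {y, z}}" if "{y, v} \<in> ?E" for v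
    using that by simp
  then have nbr_y: "v = x \<or> v = z" if "{y, v} \<in> ?E" for v
    using that by (fastforce simp: doubleton_eq_iff)
  have tri: "{u, v, w} = {x, y, z}" if "{u, v} \<in> ?E" "{v, w} \<in> ?E" "{u, w} \<in> ?E" for u v w
  proof -
    \<comment> \<open>Uniqueness identifies the two subgraphs, and hence their vertex sets.\<close>
    have "UGraph {u, v, w} {{u, v}, {v, w}, {u, w}} = UGraph {x, y, z} {{x, y}, {y, z}, {x, z}}"
      using assms(4,5) triangle_inI[OF G that] by metis
    then show ?thesis by simp
  qed
  interpret roofed_triangle ?E n x y z a b
  proof
    show "{u, v, w} = {x, y, z}" if "{u, v} \<in> ?E" "{v, w} \<in> ?E" "{u, w} \<in> ?E" for u v w
      using that by (rule tri)
  qed (use edges a b nbr_y in simp_all)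
  have sub: "\<Union>?E \<subseteq> verts G" using G by (auto simp: simple_graph_def)
  have "v \<in> {x, y, z, a, b} \<union> C \<union> D" if "v \<in> verts G" for v
  proof -
    have "x \<in> verts G" using edges(1) sub by blast
    with that have "(\<lambda>a b. {a, b} \<in> ?E)\<^sup>*\<^sup>* x v"
      using assms(2) by (simp add: connected_graph_def)
    then show ?thesis
    proof induction
      case (step u v)
      then show ?case using base_closed[of u v] by blast
    qed blast
  qed
  then have V: "verts G \<subseteq> {x, y, z, a, b} \<union> C \<union> D" by blast
  interpret roofed_triangle_spanning ?E n x y z a b
    by unfold_locales (use sub V in blast)
  have "C \<union> D \<subseteq> \<Union>?E" by (auto simp: nbrs_def)
  moreover have "{x, y, z, a, b} \<subseteq> \<Union>?E" using edges a(1) b(1) by blast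
  ultimately have "{x, y, z, a, b} \<union> C \<union> D \<subseteq> \<Union>?E" by (simp only: Un_subset_iff)
  then have V_eq: "verts G = {x, y, z, a, b} \<union> C \<union> D"
    using V sub by (metis subset_antisym subset_trans)
  have edge_sub: "e \<subseteq> verts G" if "e \<in> ?E" for e using that sub by blast
  show ?thesis
  proof (cases "D = {}")
    case True
    \<comment> \<open>The default value 1 is the label of \<open>b\<close>.\<close>
    define f :: "'a \<Rightarrow> nat" where "f = (\<lambda>_. 1)(a := 2, x := 3, z := 4, y := 5)"
    then have f: "f b = 1" "f a = 2" "f x = 3" "f z = 4" "f y = 5"
      using distinct by simp_all
    have Vh: "verts G = {b, a, x, z, y}"
      unfolding V_eq True C_empty_iff[THEN iffD2, OF True] by blast
    have "{1..5} = {1, 2, 3, 4, 5 :: nat}" by auto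
    then have image_V: "f ` verts G = verts house"
      unfolding Vh house_def by (simp add: f)
    have image_E: "(`) f ` ?E = edges house"
      unfolding house_edges[OF True] house_def by (simp add: f)
    have inj: "inj_on f (verts G)"
      unfolding Vh by (auto simp: f)
    have "G \<simeq> house" using edge_sub inj image_V image_E by (rule graph_isoI)
    then show ?thesis ..
  next
    case False
    then obtain c d where C: "C = {c}" and D: "D = {d}" and
      E: "?E = {{c, a}, {a, b}, {b, d}, {d, c}, {a, x}, {b, z}, {x, z}, {x, y}, {z, y}}"
      by (rule dream_house_edges)
    have cd: "c \<notin> {x, y, z, a, b}" "d \<notin> {x, y, z, a, b}" "c \<noteq> d"
      using in_C(2)[of c] in_D(2)[of d] C_Int_D unfolding C D by blast+
    \<comment> \<open>Here the default value 1 is the label of \<open>c\<close>.\<close>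
    define f :: "'a \<Rightarrow> nat"
      where "f = (\<lambda>_. 1)(a := 2, b := 3, d := 4, x := 5, z := 6, y := 7)"
    then have f: "f c = 1" "f a = 2" "f b = 3" "f d = 4" "f x = 5" "f z = 6" "f y = 7"
      using distinct cd by auto
    have Vh: "verts G = {c, a, b, d, x, z, y}" unfolding V_eq C D by blast
    have "{1..7} = {1, 2, 3, 4, 5, 6, 7 :: nat}" by auto
    then have image_V: "f ` verts G = verts dream_house"
      unfolding Vh dream_house_def by (simp add: f)
    have image_E: "(`) f ` ?E = edges dream_house"
      unfolding E dream_house_def by (simp add: f)
    have inj: "inj_on f (verts G)"
      unfolding Vh by (auto simp: f)
    have "G \<simeq> dream_house" using edge_sub inj image_V image_E by (rule graph_isoI)
    then show ?thesis ..
  qed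
qed

end
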